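(* Let $\Phi$ be a unital positive linear map, let $0<m_1^2\le A\le M_1^2$ and $0<m_2^2\le B\le M_2^2$, and put $m=\frac{m_2}{M_1}$, $M=\frac{M_1}{m_2}$. Then $$\Phi(A)\sharp\Phi(B)+\frac12\left(\sqrt{Mm}\,\Phi(A)+\frac{1}{\sqrt{Mm}}\,\Phi(B)-2\big(\Phi(A)\sharp\Phi(B)\big)\right)\le\frac{M+m}{2\sqrt{mM}}\,\Phi(A\sharp B).$$ In particular, if $B=A^{-1}$, then $$\Phi(A)\sharp\Phi(A^{-1})+\frac12\left(Mm\,\Phi(A)+\frac{1}{Mm}\,\Phi(A^{-1})-2\big(\Phi(A)\sharp\Phi(A^{-1})\big)\right)\le\frac{M^2+m^2}{2mM}.$$
   Context: $A,B$ are self-adjoint bounded linear operators on a complex Hilbert space $\mathscr{H}$, $\mathbb{B}(\mathscr{H})$ is the $C^*$-algebra of all bounded linear operators on $\mathscr{H}$, and $m_1,M_1,m_2,M_2$ are positive real numbers. An operator $X$ is positive, written $X\ge 0$, if $\langle Xx,x\rangle\ge 0$ for all vectors $x$; for self-adjoint operators, $X\le Y$ means $Y-X\ge 0$. A scalar in an operator inequality stands for that scalar times the identity operator $I$. The linear map $\Phi$, defined on $\mathbb{B}(\mathscr{H})$ with values in the bounded operators on a complex Hilbert space, is positive if $\Phi(X)\ge 0$ whenever $X\ge 0$, and unital if it maps the identity to the identity. For positive invertible operators $X,Y$, the geometric mean is $X\sharp Y=X^{1/2}\left(X^{-1/2}YX^{-1/2}\right)^{1/2}X^{1/2}$.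
   Formalization: As printed both inequalities are false (A=1, B=4, m_1=M_1=m_2=1, M_2=2; A=1/4, B=4, m_1=1/2, M_1=m_2=1, M_2=2). Proved with M=M_2/m_1 instead of M_1/m_2; for B=A^{-1}, m and M in the display are the square roots of m_2/M_1 and M_2/m_1. *)

theory Defs
  imports "HOL-Analysis.Analysis"
begin

text \<open>The library has real inner product spaces only. A complex Hilbert space is taken to be a
  complete real inner product space with a compatible complex structure; the norm, the topology and
  completeness are those of the library, since \<open>norm x = sqrt (Re (cinner x x))\<close>.
  The complex inner product is linear in its first argument.\<close>

class complex_hilbert_space = real_inner + complete_space +
  fixes scaleC :: "complex \<Rightarrow> 'a \<Rightarrow> 'a" (infixr \<open>*\<^sub>C\<close> 75)
    and cinner :: "'a \<Rightarrow> 'a \<Rightarrow> complex"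
  assumes scaleC_add_right: "c *\<^sub>C (x + y) = c *\<^sub>C x + c *\<^sub>C y"
    and scaleC_add_left: "(c + d) *\<^sub>C x = c *\<^sub>C x + d *\<^sub>C x"
    and scaleC_scaleC: "c *\<^sub>C (d *\<^sub>C x) = (c * d) *\<^sub>C x"
    and scaleC_one: "1 *\<^sub>C x = x"
    and scaleR_eq_scaleC: "r *\<^sub>R x = complex_of_real r *\<^sub>C x"
    and cinner_commute: "cinner x y = cnj (cinner y x)"
    and cinner_add_left: "cinner (x + y) z = cinner x z + cinner y z"
    and cinner_scaleC_left: "cinner (c *\<^sub>C x) y = c * cinner x y"
    and inner_eq_Re_cinner: "inner x y = Re (cinner x y)"

instantiation complex :: complex_hilbert_space
begin

definition "scaleC c x = c * x" for c x :: complex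
definition "cinner x y = x * cnj y" for x y :: complex

instance
  by standard (auto simp: scaleC_complex_def cinner_complex_def algebra_simps scaleR_conv_of_real
      inner_complex_def)

end

lemma cinner_self: "cinner x x = complex_of_real ((norm x)\<^sup>2)"
  for x :: "'a::complex_hilbert_space"
proof -
  have "Im (cinner x x) = 0"
    using arg_cong[OF cinner_commute[of x x], of Im] by simp
  moreover have "Re (cinner x x) = (norm x)\<^sup>2"
    by (metis inner_eq_Re_cinner power2_norm_eq_inner)
  ultimately show ?thesis by (simp add: complex_eq_iff)
qed

text \<open>The library type \<open>'a \<Rightarrow>\<^sub>L 'a\<close> consists of the real-linear bounded operators, so the algebra of
  all bounded operators on a complex Hilbert space is the following subset of it.\<close>

definition bop :: "('a::complex_hilbert_space \<Rightarrow>\<^sub>L 'a) set" where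
  "bop = {T. \<forall>c x. blinfun_apply T (c *\<^sub>C x) = c *\<^sub>C blinfun_apply T x}"

definition op_scaleC :: "complex \<Rightarrow> ('a::complex_hilbert_space \<Rightarrow>\<^sub>L 'a) \<Rightarrow> ('a \<Rightarrow>\<^sub>L 'a)" where
  "op_scaleC c T = Blinfun (\<lambda>x. c *\<^sub>C blinfun_apply T x)"

definition self_adjoint :: "('a::complex_hilbert_space \<Rightarrow>\<^sub>L 'a) \<Rightarrow> bool" where
  "self_adjoint T \<longleftrightarrow> T \<in> bop \<and>
     (\<forall>x y. cinner (blinfun_apply T x) y = cinner x (blinfun_apply T y))"

definition op_pos :: "('a::complex_hilbert_space \<Rightarrow>\<^sub>L 'a) \<Rightarrow> bool" where
  "op_pos T \<longleftrightarrow> T \<in> bop \<and>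
     (\<forall>x. cinner (blinfun_apply T x) x \<in> \<real> \<and> 0 \<le> Re (cinner (blinfun_apply T x) x))"

definition op_le :: "('a::complex_hilbert_space \<Rightarrow>\<^sub>L 'a) \<Rightarrow> ('a \<Rightarrow>\<^sub>L 'a) \<Rightarrow> bool"
    (infix \<open>\<preceq>\<close> 50) where
  "S \<preceq> T \<longleftrightarrow> op_pos (T - S)"

text \<open>The next two descriptions are meaningful for invertible, respectively positive, operators;
  the positive square root of a positive operator exists and is unique.\<close>

definition op_inv :: "('a::complex_hilbert_space \<Rightarrow>\<^sub>L 'a) \<Rightarrow> ('a \<Rightarrow>\<^sub>L 'a)" where
  "op_inv T = (THE S. S \<in> bop \<and> S o\<^sub>L T = id_blinfun \<and> T o\<^sub>L S = id_blinfun)"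

definition op_sqrt :: "('a::complex_hilbert_space \<Rightarrow>\<^sub>L 'a) \<Rightarrow> ('a \<Rightarrow>\<^sub>L 'a)" where
  "op_sqrt T = (THE S. op_pos S \<and> S o\<^sub>L S = T)"

definition geo_mean :: "('a::complex_hilbert_space \<Rightarrow>\<^sub>L 'a) \<Rightarrow> ('a \<Rightarrow>\<^sub>L 'a) \<Rightarrow> ('a \<Rightarrow>\<^sub>L 'a)"
    (infixl \<open>\<sharp>\<close> 80) where
  "X \<sharp> Y = op_sqrt X o\<^sub>L op_sqrt (op_inv (op_sqrt X) o\<^sub>L Y o\<^sub>L op_inv (op_sqrt X)) o\<^sub>L op_sqrt X"

text \<open>Maps between operator algebras are only constrained on \<open>bop\<close>; their values elsewhere are
  irrelevant.\<close>

definition op_linear_map ::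
    "(('a::complex_hilbert_space \<Rightarrow>\<^sub>L 'a) \<Rightarrow> ('b::complex_hilbert_space \<Rightarrow>\<^sub>L 'b)) \<Rightarrow> bool" where
  "op_linear_map \<Phi> \<longleftrightarrow>
     (\<forall>X\<in>bop. \<Phi> X \<in> bop) \<and>
     (\<forall>X\<in>bop. \<forall>Y\<in>bop. \<Phi> (X + Y) = \<Phi> X + \<Phi> Y) \<and>
     (\<forall>c. \<forall>X\<in>bop. \<Phi> (op_scaleC c X) = op_scaleC c (\<Phi> X))"

definition positive_map ::
    "(('a::complex_hilbert_space \<Rightarrow>\<^sub>L 'a) \<Rightarrow> ('b::complex_hilbert_space \<Rightarrow>\<^sub>L 'b)) \<Rightarrow> bool" where
  "positive_map \<Phi> \<longleftrightarrow> (\<forall>X. op_pos X \<longrightarrow> op_pos (\<Phi> X))"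

definition unital_map ::
    "(('a::complex_hilbert_space \<Rightarrow>\<^sub>L 'a) \<Rightarrow> ('b::complex_hilbert_space \<Rightarrow>\<^sub>L 'b)) \<Rightarrow> bool" where
  "unital_map \<Phi> \<longleftrightarrow> \<Phi> id_blinfun = id_blinfun"

lemma norm_scaleC: "norm (c *\<^sub>C x) = cmod c * norm x"
  for x :: "'a::complex_hilbert_space"
proof -
  have "cinner (c *\<^sub>C x) (c *\<^sub>C x) = c * cnj c * cinner x x"
    by (metis cinner_commute cinner_scaleC_left complex_cnj_mult mult.assoc)
  hence "complex_of_real ((norm (c *\<^sub>C x))\<^sup>2) = complex_of_real ((cmod c * norm x)\<^sup>2)"
    by (simp only: cinner_self complex_norm_square[symmetric] power_mult_distrib
        of_real_mult of_real_power)
  hence "(norm (c *\<^sub>C x))\<^sup>2 = (cmod c * norm x)\<^sup>2"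
    using of_real_eq_iff by blast
  thus ?thesis by (simp add: power2_eq_iff_nonneg)
qed

lemma bounded_linear_scaleC: "bounded_linear (\<lambda>x::'a::complex_hilbert_space. c *\<^sub>C x)"
  by (rule bounded_linear_intro[where K = "cmod c"])
    (simp_all add: scaleC_add_right scaleR_eq_scaleC scaleC_scaleC norm_scaleC mult.commute)

lemma op_scaleC_apply: "blinfun_apply (op_scaleC c T) x = c *\<^sub>C blinfun_apply T x"
  unfolding op_scaleC_def
  by (subst bounded_linear_Blinfun_apply)
    (auto intro: bounded_linear_compose[OF bounded_linear_scaleC blinfun.bounded_linear_right])

end

theory Submission
  imports Defs
begin

text \<open>
  The terms with \<open>\<Phi> A \<sharp> \<Phi> B\<close> on the left-hand side cancel, so with \<open>s = sqrt (M * m)\<close> the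
  claim becomes
  \<open>(s \<Phi>(A) + \<Phi>(B) / s) / 2 \<le> (M + m) / (2 s) \<Phi>(A \<sharp> B)\<close>, and since \<open>\<Phi>\<close> is linear and monotone
  it follows from the operator inequality

    \<open>M m A + B \<le> (M + m) (A \<sharp> B)\<close>    (\<open>chord_le_geo_mean\<close>).

  The bounds on \<open>A\<close> and \<open>B\<close> make \<open>A\<close> invertible and give \<open>m\<^sup>2 A \<le> B \<le> M\<^sup>2 A\<close>. Conjugating with the inverse root of
  \<open>A\<close> turns this into \<open>m\<^sup>2 \<le> C \<le> M\<^sup>2\<close> for \<open>C = A\<^sup>-\<^sup>1\<^sup>/\<^sup>2 B A\<^sup>-\<^sup>1\<^sup>/\<^sup>2\<close>, so \<open>D = C\<^sup>1\<^sup>/\<^sup>2\<close> lies between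
  \<open>m\<close> and \<open>M\<close>. Then \<open>(D - m) (M - D) \<ge> 0\<close>, which says that the parabola \<open>D\<^sup>2\<close> stays below its chord:
  \<open>D\<^sup>2 + M m \<le> (M + m) D\<close> (\<open>chord_inequality\<close>). Conjugating back with the root of \<open>A\<close> maps
  \<open>D\<^sup>2\<close> to \<open>B\<close>, \<open>1\<close> to \<open>A\<close> and \<open>D\<close> to \<open>A \<sharp> B\<close>. The case \<open>B = A\<^sup>-\<^sup>1\<close> is the same inequality
  together with \<open>A \<sharp> A\<^sup>-\<^sup>1 = 1\<close> (\<open>geo_mean_op_inv\<close>).

  What remains is to know that roots and inverses, given by definite descriptions, exist and are
  unique. Every operator whose root or inverse enters this argument is bounded below by a positive
  scalar, so after rescaling it is \<open>1 - X\<close> with \<open>\<parallel>X\<parallel> < 1\<close> (\<open>strictly_positive_near_scalar\<close>), and both the inverse and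
  the root are fixed points of contractions on closed sets of operators
  (\<open>strictly_positive_invertible\<close>, \<open>strictly_positive_sqrt_exists\<close>).
\<close>

section \<open>Complex-linear and self-adjoint operators\<close>

text \<open>Completeness of the operator space, on which the fixed point arguments rest, is available for
  targets in the class \<open>banach\<close>.\<close>

instance complex_hilbert_space \<subseteq> banach ..

lemma zero_in_bop: "0 \<in> bop"
  unfolding bop_def using linear_0[OF bounded_linear.linear[OF bounded_linear_scaleC]] by auto

lemma id_in_bop: "id_blinfun \<in> bop"
  by (simp add: bop_def)

lemma add_in_bop: "S \<in> bop \<Longrightarrow> T \<in> bop \<Longrightarrow> S + T \<in> bop"
  by (simp add: bop_def blinfun.add_left scaleC_add_right)

lemma scaleR_in_bop: "T \<in> bop \<Longrightarrow> r *\<^sub>R T \<in> bop"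
  by (simp add: bop_def blinfun.scaleR_left scaleR_eq_scaleC scaleC_scaleC mult.commute)

lemma diff_in_bop: "S \<in> bop \<Longrightarrow> T \<in> bop \<Longrightarrow> S - T \<in> bop"
  using add_in_bop[OF _ scaleR_in_bop[of T "-1"], of S] by simp

lemma compose_in_bop: "S \<in> bop \<Longrightarrow> T \<in> bop \<Longrightarrow> S o\<^sub>L T \<in> bop"
  by (simp add: bop_def)

lemmas bop_intros =
  zero_in_bop id_in_bop add_in_bop diff_in_bop scaleR_in_bop compose_in_bop

lemma self_adjoint_imp_bop: "self_adjoint T \<Longrightarrow> T \<in> bop"
  by (simp add: self_adjoint_def)

text \<open>For complex-linear \<open>T\<close>, symmetry for the real part of the inner product suffices: replacing
  \<open>x\<close> by \<open>\<i> x\<close> turns real parts into imaginary parts. Everything below can therefore be argued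
  with the real inner product and the tools for it.\<close>

lemma self_adjoint_iff_inner:
  "self_adjoint T \<longleftrightarrow> T \<in> bop \<and> (\<forall>x y. inner (blinfun_apply T x) y = inner x (blinfun_apply T y))"
proof (intro iffI conjI allI)
  fix x y
  assume "T \<in> bop \<and> (\<forall>x y. inner (blinfun_apply T x) y = inner x (blinfun_apply T y))"
  hence T: "T \<in> bop" and sym: "\<And>x y. inner (blinfun_apply T x) y = inner x (blinfun_apply T y)"
    by auto
  have Re_eq: "Re (cinner (blinfun_apply T x) y) = Re (cinner x (blinfun_apply T y))" for x y
    using sym by (simp add: inner_eq_Re_cinner)
  have "Re (cinner (blinfun_apply T (\<i> *\<^sub>C x)) y) = Re (cinner (\<i> *\<^sub>C x) (blinfun_apply T y))" for x y
    by (rule Re_eq)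
  hence "Im (cinner (blinfun_apply T x) y) = Im (cinner x (blinfun_apply T y))" for x y
    using T by (simp add: bop_def cinner_scaleC_left)
  with Re_eq show "self_adjoint T"
    using T by (simp add: self_adjoint_def complex_eq_iff)
qed (simp_all add: self_adjoint_def inner_eq_Re_cinner)

lemma self_adjoint_inner:
  "self_adjoint T \<Longrightarrow> inner (blinfun_apply T x) y = inner x (blinfun_apply T y)"
  by (simp add: self_adjoint_iff_inner)

lemma self_adjoint_id: "self_adjoint id_blinfun"
  by (simp add: self_adjoint_iff_inner id_in_bop)

lemma self_adjoint_zero: "self_adjoint 0"
  by (simp add: self_adjoint_iff_inner zero_in_bop)

lemma self_adjoint_add: "self_adjoint S \<Longrightarrow> self_adjoint T \<Longrightarrow> self_adjoint (S + T)"
  by (simp add: self_adjoint_iff_inner add_in_bop blinfun.add_left inner_add_left inner_add_right)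

lemma self_adjoint_diff: "self_adjoint S \<Longrightarrow> self_adjoint T \<Longrightarrow> self_adjoint (S - T)"
  by (simp add: self_adjoint_iff_inner diff_in_bop blinfun.diff_left inner_diff_left inner_diff_right)

lemma self_adjoint_scaleR: "self_adjoint T \<Longrightarrow> self_adjoint (r *\<^sub>R T)"
  by (simp add: self_adjoint_iff_inner scaleR_in_bop blinfun.scaleR_left)

lemma self_adjoint_square: "self_adjoint T \<Longrightarrow> self_adjoint (T o\<^sub>L T)"
  by (simp add: self_adjoint_iff_inner compose_in_bop)

lemma self_adjoint_conjugate:
  "self_adjoint S \<Longrightarrow> self_adjoint T \<Longrightarrow> self_adjoint (S o\<^sub>L T o\<^sub>L S)"
  by (simp add: self_adjoint_iff_inner compose_in_bop)

lemma self_adjoint_inverse: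
  assumes "self_adjoint S" and "R \<in> bop" and "S o\<^sub>L R = id_blinfun"
  shows "self_adjoint R"
proof -
  have SR: "blinfun_apply S (blinfun_apply R x) = x" for x
    using arg_cong[OF assms(3), of "\<lambda>T. blinfun_apply T x"] by simp
  have "inner (blinfun_apply R x) y = inner x (blinfun_apply R y)" for x y
    using self_adjoint_inner[OF assms(1), of "blinfun_apply R x" "blinfun_apply R y"]
    by (simp add: SR)
  thus ?thesis using assms(2) by (simp add: self_adjoint_iff_inner)
qed

section \<open>Order and norm of self-adjoint operators\<close>

lemma op_pos_iff_inner:
  assumes "self_adjoint T"
  shows "op_pos T \<longleftrightarrow> (\<forall>x. 0 \<le> inner (blinfun_apply T x) x)"
proof -
  have "cinner (blinfun_apply T x) x = cnj (cinner (blinfun_apply T x) x)" for x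
    using assms cinner_commute[of x "blinfun_apply T x"] by (simp add: self_adjoint_def)
  thus ?thesis
    using assms by (simp add: op_pos_def self_adjoint_def inner_eq_Re_cinner
        Reals_cnj_iff)
qed

lemma op_pos_scaleR:
  assumes "op_pos T" and "0 \<le> r"
  shows "op_pos (r *\<^sub>R T)"
  using assms
  by (auto simp: op_pos_def scaleR_in_bop blinfun.scaleR_left scaleR_eq_scaleC[of r]
      cinner_scaleC_left)

lemma scaleR_id_le_iff:
  assumes "self_adjoint T"
  shows "c *\<^sub>R id_blinfun \<preceq> T \<longleftrightarrow> (\<forall>x. c * (norm x)\<^sup>2 \<le> inner (blinfun_apply T x) x)"
  unfolding op_le_def
  by (subst op_pos_iff_inner)
    (simp_all add: assms self_adjoint_diff self_adjoint_scaleR self_adjoint_id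
      blinfun.diff_left blinfun.scaleR_left inner_diff_left power2_norm_eq_inner)

lemma le_scaleR_id_iff:
  assumes "self_adjoint T"
  shows "T \<preceq> c *\<^sub>R id_blinfun \<longleftrightarrow> (\<forall>x. inner (blinfun_apply T x) x \<le> c * (norm x)\<^sup>2)"
  unfolding op_le_def
  by (subst op_pos_iff_inner)
    (simp_all add: assms self_adjoint_diff self_adjoint_scaleR self_adjoint_id
      blinfun.diff_left blinfun.scaleR_left inner_diff_left power2_norm_eq_inner)

lemma strictly_positive_imp_op_pos:
  assumes "self_adjoint T" and "0 \<le> c" and "c *\<^sub>R id_blinfun \<preceq> T"
  shows "op_pos T"
  using assms by (simp add: scaleR_id_le_iff op_pos_iff_inner)
    (meson order_trans mult_nonneg_nonneg zero_le_power2)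

text \<open>The usual argument for a positive semidefinite form: \<open>x - t y\<close> has a nonnegative form value
  for every real \<open>t\<close>.\<close>

lemma positive_operator_Cauchy_Schwarz:
  assumes "self_adjoint T" and pos: "\<And>x. 0 \<le> inner (blinfun_apply T x) x"
  shows "(inner (blinfun_apply T x) y)\<^sup>2
    \<le> inner (blinfun_apply T x) x * inner (blinfun_apply T y) y"
proof -
  let ?f = "\<lambda>x y. inner (blinfun_apply T x) y"
  have sym: "?f y x = ?f x y"
    using self_adjoint_inner[OF assms(1), of y x] by (simp add: inner_commute)
  have quad: "0 \<le> ?f x x - 2 * t * ?f x y + t\<^sup>2 * ?f y y" for t
    using pos[of "x - t *\<^sub>R y"] sym
    by (simp add: blinfun.diff_right blinfun.scaleR_right inner_diff_left inner_diff_right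
        power2_eq_square algebra_simps)
  show ?thesis
  proof (cases "?f y y = 0")
    case True
    have "?f x y = 0"
    proof (rule ccontr)
      assume "?f x y \<noteq> 0"
      \<comment> \<open>The form value at \<open>x - t y\<close> is affine in \<open>t\<close>; this \<open>t\<close> makes it \<open>-1\<close>.\<close>
      thus False
        using quad[of "(?f x x + 1) / (2 * ?f x y)"] True by simp
    qed
    thus ?thesis by (simp add: True)
  next
    case False
    hence yy: "0 < ?f y y" using pos[of y] by simp
    have "0 \<le> ?f x x - (?f x y)\<^sup>2 / ?f y y"
      using quad[of "?f x y / ?f y y"] False by (simp add: power2_eq_square field_simps)
    thus ?thesis using yy by (simp add: field_simps)
  qed
qed

text \<open>This is \<open>T\<^sup>2 \<le> d T\<close> for \<open>0 \<le> T \<le> d\<close>, the operator version of \<open>t\<^sup>2 \<le> d t\<close> on \<open>[0, d]\<close>. It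
  comes from Cauchy--Schwarz for the form of \<open>T\<close> at \<open>x\<close> and \<open>T x\<close>. It yields the norm bound
  \<open>\<parallel>T\<parallel> \<le> d\<close> as well as the chord inequality.\<close>

lemma square_le_multiple:
  assumes "self_adjoint T"
    and pos: "\<And>x. 0 \<le> inner (blinfun_apply T x) x"
    and bound: "\<And>x. inner (blinfun_apply T x) x \<le> d * (norm x)\<^sup>2"
  shows "(norm (blinfun_apply T x))\<^sup>2 \<le> d * inner (blinfun_apply T x) x"
proof (cases "blinfun_apply T x = 0")
  case True
  thus ?thesis by simp
next
  case False
  let ?y = "blinfun_apply T x"
  have "(norm ?y)\<^sup>2 * (norm ?y)\<^sup>2 \<le> inner ?y x * inner (blinfun_apply T ?y) ?y"
    using positive_operator_Cauchy_Schwarz[OF assms(1) pos, of x ?y]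
    unfolding power2_norm_eq_inner by (simp only: power2_eq_square)
  also have "\<dots> \<le> inner ?y x * (d * (norm ?y)\<^sup>2)"
    by (intro mult_left_mono bound pos)
  finally have "(norm ?y)\<^sup>2 * (norm ?y)\<^sup>2 \<le> (d * inner ?y x) * (norm ?y)\<^sup>2"
    by (simp add: ac_simps)
  thus ?thesis by (rule mult_right_le_imp_le) (simp add: False)
qed

text \<open>If \<open>c \<le> T \<le> K\<close> then \<open>0 \<le> 1 - T / K \<le> 1 - c / K\<close>, and for such a positive operator the
  upper bound also bounds the norm. The sharp constant \<open>1 - c / K\<close> is what later gives the sharp lower
  bound for the root.\<close>

lemma strictly_positive_near_scalar:
  fixes T :: "'a::complex_hilbert_space \<Rightarrow>\<^sub>L 'a"
  assumes T: "self_adjoint T" and c: "0 < c" and low: "c *\<^sub>R id_blinfun \<preceq> T"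
  obtains K where "c \<le> K" and "norm (id_blinfun - (1 / K) *\<^sub>R T) \<le> 1 - c / K"
proof -
  \<comment> \<open>Adding \<open>c\<close> to the norm keeps \<open>K\<close> positive and at least \<open>c\<close> even on the zero space.\<close>
  define K where "K = norm T + c"
  let ?X = "id_blinfun - (1 / K) *\<^sub>R T"
  have cK: "c \<le> K" by (simp add: K_def)
  have K: "0 < K" unfolding K_def using c norm_ge_zero[of T] by linarith
  have form: "inner (blinfun_apply ?X x) x
      = (norm x)\<^sup>2 - inner (blinfun_apply T x) x / K" for x
    by (simp add: blinfun.diff_left blinfun.scaleR_left inner_diff_left power2_norm_eq_inner)
  have low': "c * (norm x)\<^sup>2 \<le> inner (blinfun_apply T x) x" for x
    using low T by (simp add: scaleR_id_le_iff)
  have up: "inner (blinfun_apply T x) x \<le> K * (norm x)\<^sup>2" for x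
  proof -
    have "inner (blinfun_apply T x) x \<le> norm (blinfun_apply T x) * norm x"
      by (rule norm_cauchy_schwarz)
    also have "\<dots> \<le> (norm T * norm x) * norm x"
      by (intro mult_right_mono norm_blinfun) simp
    also have "\<dots> \<le> K * (norm x)\<^sup>2"
      using c by (simp add: K_def power2_eq_square algebra_simps)
    finally show ?thesis .
  qed
  have X: "self_adjoint ?X"
    by (intro self_adjoint_diff self_adjoint_id self_adjoint_scaleR T)
  have X0: "0 \<le> inner (blinfun_apply ?X x) x" for x
    using up[of x] K by (simp add: form field_simps)
  have X1: "inner (blinfun_apply ?X x) x \<le> (1 - c / K) * (norm x)\<^sup>2" for x
    using low'[of x] K by (simp add: form field_simps)
  have q: "0 \<le> 1 - c / K"
    using K cK by simp
  have "norm ?X \<le> 1 - c / K"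
  proof (rule norm_blinfun_bound[OF q])
    fix x
    have "(norm (blinfun_apply ?X x))\<^sup>2 \<le> (1 - c / K) * inner (blinfun_apply ?X x) x"
      by (rule square_le_multiple[OF X X0 X1])
    also have "\<dots> \<le> (1 - c / K) * ((1 - c / K) * (norm x)\<^sup>2)"
      by (intro mult_left_mono X1 q)
    finally have "(norm (blinfun_apply ?X x))\<^sup>2 \<le> ((1 - c / K) * norm x)\<^sup>2"
      unfolding power_mult_distrib by (simp only: power2_eq_square mult.assoc)
    thus "norm (blinfun_apply ?X x) \<le> (1 - c / K) * norm x"
      by (rule power2_le_imp_le) (intro mult_nonneg_nonneg q norm_ge_zero)
  qed
  with cK show thesis by (rule that)
qed

section \<open>Inverses by a contraction\<close>

lemma closed_bop: "closed bop"
  unfolding bop_def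
  by (intro closed_Collect_all closed_Collect_eq continuous_intros
      bounded_linear.continuous_on[OF bounded_linear_scaleC])

lemma closed_self_adjoint: "closed (Collect self_adjoint)"
proof -
  have "Collect self_adjoint = bop \<inter>
      {T. \<forall>x y. inner (blinfun_apply T x) y = inner x (blinfun_apply T y)}"
    by (auto simp: self_adjoint_iff_inner)
  also have "closed \<dots>"
    by (intro closed_Int closed_bop closed_Collect_all closed_Collect_eq continuous_intros)
  finally show ?thesis .
qed

lemma continuous_on_compose_left:
  "continuous_on UNIV (\<lambda>T. R o\<^sub>L T)"
  by (intro linear_continuous_on bounded_bilinear.bounded_linear_right[OF bounded_bilinear_blinfun_compose])

lemma continuous_on_compose_right:
  "continuous_on UNIV (\<lambda>T. T o\<^sub>L R)"
  by (intro linear_continuous_on bounded_bilinear.bounded_linear_left[OF bounded_bilinear_blinfun_compose])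

lemma closed_commutant: "closed {T. \<forall>R. P R \<longrightarrow> R o\<^sub>L T = T o\<^sub>L R}"
  by (intro closed_Collect_all closed_Collect_imp closed_Collect_eq
      continuous_on_compose_left continuous_on_compose_right) simp

text \<open>With \<open>S = K (1 - X)\<close> and \<open>\<parallel>X\<parallel> < 1\<close>, the inverse is the fixed point of
  \<open>Z \<mapsto> 1 / K + X Z\<close>. The fixed point equation only makes it a right inverse; looking for it among the
  operators that commute with \<open>X\<close> makes it a left inverse too.\<close>

lemma strictly_positive_invertible:
  fixes S :: "'a::complex_hilbert_space \<Rightarrow>\<^sub>L 'a"
  assumes S: "self_adjoint S" and c: "0 < c" and low: "c *\<^sub>R id_blinfun \<preceq> S"
  shows "\<exists>R\<in>bop. R o\<^sub>L S = id_blinfun \<and> S o\<^sub>L R = id_blinfun"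
proof -
  obtain K where K: "c \<le> K" and nX: "norm (id_blinfun - (1 / K) *\<^sub>R S) \<le> 1 - c / K"
    using strictly_positive_near_scalar[OF S c low] .
  define X where "X = id_blinfun - (1 / K) *\<^sub>R S"
  define f where "f Z = (1 / K) *\<^sub>R id_blinfun + (X o\<^sub>L Z)" for Z
  have X: "X \<in> bop"
    unfolding X_def by (intro bop_intros self_adjoint_imp_bop S)
  let ?s = "bop \<inter> {Z. X o\<^sub>L Z = Z o\<^sub>L X}"
  have "\<exists>!Z\<in>?s. f Z = Z"
  proof (rule Banach_fix[where c = "1 - c / K"])
    show "complete ?s"
      unfolding complete_eq_closed
      by (intro closed_Int closed_bop closed_Collect_eq
          continuous_on_compose_left continuous_on_compose_right)
    show "?s \<noteq> {}"
      using zero_in_bop by force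
    show "0 \<le> 1 - c / K" "1 - c / K < 1"
      using K c by (simp_all add: field_simps)
    show "f ` ?s \<subseteq> ?s"
    proof (rule image_subsetI)
      fix Z assume Z: "Z \<in> ?s"
      have "X o\<^sub>L Z = Z o\<^sub>L X" using Z by blast
      hence "blinfun_apply X (blinfun_apply Z x) = blinfun_apply Z (blinfun_apply X x)" for x
        by (metis blinfun_apply_blinfun_compose)
      hence "X o\<^sub>L f Z = f Z o\<^sub>L X"
        by (intro blinfun_eqI)
          (simp add: f_def blinfun.add_left blinfun.add_right blinfun.scaleR_left
            blinfun.scaleR_right)
      moreover have "f Z \<in> bop"
        unfolding f_def using Z by (intro bop_intros X) simp
      ultimately show "f Z \<in> ?s" by simp
    qed
    fix Z W assume "Z \<in> ?s" "W \<in> ?s"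
    have "f Z - f W = X o\<^sub>L (Z - W)"
      by (rule blinfun_eqI) (simp add: f_def blinfun.diff_left blinfun.diff_right blinfun.add_left)
    hence "dist (f Z) (f W) \<le> norm X * dist Z W"
      by (simp add: dist_norm norm_blinfun_compose)
    also have "\<dots> \<le> (1 - c / K) * dist Z W"
      using nX by (intro mult_right_mono) (simp_all add: X_def)
    finally show "dist (f Z) (f W) \<le> (1 - c / K) * dist Z W" .
  qed
  then obtain Z where Z: "Z \<in> bop" "X o\<^sub>L Z = Z o\<^sub>L X" and fix_Z: "f Z = Z"
    by auto
  have K0: "K \<noteq> 0" using c K by simp
  have SZ: "blinfun_apply S (blinfun_apply Z x) = x" for x
    using arg_cong[OF fix_Z, of "\<lambda>T. K *\<^sub>R blinfun_apply T x"] K0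
    by (simp add: f_def X_def blinfun.add_left blinfun.diff_left blinfun.scaleR_left algebra_simps)
  have "blinfun_apply Z (blinfun_apply S x) = blinfun_apply S (blinfun_apply Z x)" for x
    using arg_cong[OF Z(2), of "\<lambda>T. K *\<^sub>R blinfun_apply T x"] K0
    by (simp add: X_def blinfun.diff_left blinfun.diff_right blinfun.scaleR_left
        blinfun.scaleR_right algebra_simps)
  hence "Z o\<^sub>L S = id_blinfun" "S o\<^sub>L Z = id_blinfun"
    by (auto intro!: blinfun_eqI simp: SZ)
  thus ?thesis using Z(1) by blast
qed

lemma op_inv_eqI:
  assumes "R \<in> bop" and "R o\<^sub>L S = id_blinfun" and "S o\<^sub>L R = id_blinfun"
  shows "op_inv S = R"
  unfolding op_inv_def
proof (rule the_equality)
  fix R' assume "R' \<in> bop \<and> R' o\<^sub>L S = id_blinfun \<and> S o\<^sub>L R' = id_blinfun"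
  hence R': "R' o\<^sub>L S = id_blinfun" by blast
  show "R' = R"
  proof (rule blinfun_eqI)
    fix x
    have "blinfun_apply S (blinfun_apply R x) = x"
      using arg_cong[OF assms(3), of "\<lambda>T. blinfun_apply T x"] by simp
    thus "blinfun_apply R' x = blinfun_apply R x"
      using arg_cong[OF R', of "\<lambda>T. blinfun_apply T (blinfun_apply R x)"] by simp
  qed
qed (use assms in blast)

section \<open>Square roots by a contraction\<close>

text \<open>Write \<open>T = K (1 - X)\<close>. Then \<open>K\<^sup>1\<^sup>/\<^sup>2 (1 - Y)\<close> squares to \<open>T\<close> iff \<open>Y = (X + Y\<^sup>2) / 2\<close>. Since
  \<open>Y\<^sup>2 - Z\<^sup>2 = Y (Y - Z) + (Y - Z) Z\<close>, this map contracts the ball of radius \<open>r < 1\<close> by the factor \<open>r\<close>,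
  and it preserves the ball as soon as \<open>\<parallel>X\<parallel> \<le> 2 r - r\<^sup>2\<close>. The smallest such radius,
  \<open>r = 1 - c / K\<^sup>1\<^sup>/\<^sup>2\<close>, gives the sharp lower bound \<open>c\<close> for the root. The map also preserves
  self-adjointness and commutation with everything that commutes with \<open>T\<close>; the latter is recorded because
  uniqueness of the root depends on it.\<close>

lemma strictly_positive_sqrt_exists:
  fixes T :: "'a::complex_hilbert_space \<Rightarrow>\<^sub>L 'a"
  assumes T: "self_adjoint T" and c: "0 < c" and low: "c\<^sup>2 *\<^sub>R id_blinfun \<preceq> T"
  shows "\<exists>S. self_adjoint S \<and> c *\<^sub>R id_blinfun \<preceq> S \<and> S o\<^sub>L S = T
    \<and> (\<forall>R. R o\<^sub>L T = T o\<^sub>L R \<longrightarrow> R o\<^sub>L S = S o\<^sub>L R)"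
proof -
  obtain K where K: "c\<^sup>2 \<le> K" and nX: "norm (id_blinfun - (1 / K) *\<^sub>R T) \<le> 1 - c\<^sup>2 / K"
    using strictly_positive_near_scalar[OF T _ low] c by auto
  have K0: "0 < K" using K c by (meson less_le_trans zero_less_power)
  define X where "X = id_blinfun - (1 / K) *\<^sub>R T"
  define r where "r = 1 - c / sqrt K"
  define f where "f Y = (1/2) *\<^sub>R (X + (Y o\<^sub>L Y))" for Y
  have r: "0 \<le> r" "r < 1"
    using c K0 K real_le_rsqrt[of c K] by (simp_all add: r_def)
  have X_le: "norm X \<le> 2 * r - r\<^sup>2"
    using nX K0 by (simp add: X_def r_def power2_eq_square algebra_simps)
  have X: "self_adjoint X"
    unfolding X_def by (intro self_adjoint_diff self_adjoint_id self_adjoint_scaleR T)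
  let ?s = "Collect self_adjoint \<inter> cball 0 r \<inter> {Y. \<forall>R. R o\<^sub>L T = T o\<^sub>L R \<longrightarrow> R o\<^sub>L Y = Y o\<^sub>L R}"
  have "\<exists>!Y\<in>?s. f Y = Y"
  proof (rule Banach_fix[where c = r])
    show "complete ?s"
      unfolding complete_eq_closed
      by (intro closed_Int closed_self_adjoint closed_cball closed_commutant)
    show "?s \<noteq> {}"
      using self_adjoint_zero r by force
    show "f ` ?s \<subseteq> ?s"
    proof (rule image_subsetI)
      fix Y assume Y: "Y \<in> ?s"
      have "norm (f Y) \<le> (1/2) * (norm X + norm (Y o\<^sub>L Y))"
        by (simp add: f_def norm_triangle_ineq)
      also have "norm (Y o\<^sub>L Y) \<le> r * r"
        using Y r by (intro order_trans[OF norm_blinfun_compose] mult_mono) auto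
      also have "(1/2) * (norm X + r * r) \<le> r"
        using X_le by (simp add: power2_eq_square)
      finally have "norm (f Y) \<le> r" by simp
      moreover have "self_adjoint (f Y)"
        unfolding f_def using Y
        by (intro self_adjoint_scaleR self_adjoint_add X self_adjoint_square) simp
      moreover have "R o\<^sub>L f Y = f Y o\<^sub>L R" if R: "R o\<^sub>L T = T o\<^sub>L R" for R
      proof -
        have RT: "blinfun_apply R (blinfun_apply T x) = blinfun_apply T (blinfun_apply R x)" for x
          using arg_cong[OF R, of "\<lambda>T. blinfun_apply T x"] by simp
        have "R o\<^sub>L Y = Y o\<^sub>L R" using Y R by blast
        hence RY: "blinfun_apply R (blinfun_apply Y x) = blinfun_apply Y (blinfun_apply R x)" for x
          by (metis blinfun_apply_blinfun_compose)
        show ?thesis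
          by (rule blinfun_eqI)
            (simp add: f_def X_def blinfun.add_left blinfun.add_right blinfun.diff_left
              blinfun.diff_right blinfun.scaleR_left blinfun.scaleR_right RT RY)
      qed
      ultimately show "f Y \<in> ?s" by simp
    qed
    fix Y Z assume Y: "Y \<in> ?s" and Z: "Z \<in> ?s"
    have "f Y - f Z = (1/2) *\<^sub>R ((Y o\<^sub>L (Y - Z)) + ((Y - Z) o\<^sub>L Z))"
      by (rule blinfun_eqI)
        (simp add: f_def blinfun.diff_left blinfun.diff_right blinfun.add_left blinfun.scaleR_left
          algebra_simps)
    hence "dist (f Y) (f Z) \<le> (1/2) * (norm (Y o\<^sub>L (Y - Z)) + norm ((Y - Z) o\<^sub>L Z))"
      by (simp add: dist_norm norm_triangle_ineq)
    also have "norm (Y o\<^sub>L (Y - Z)) \<le> r * norm (Y - Z)"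
      using Y by (intro order_trans[OF norm_blinfun_compose] mult_right_mono) auto
    also have "norm ((Y - Z) o\<^sub>L Z) \<le> norm (Y - Z) * r"
      using Z by (intro order_trans[OF norm_blinfun_compose] mult_left_mono) auto
    finally show "dist (f Y) (f Z) \<le> r * dist Y Z"
      by (simp add: dist_norm)
  qed (use r in auto)
  then obtain Y where Y: "self_adjoint Y" "norm Y \<le> r" and fix_Y: "f Y = Y"
    and comm: "\<And>R. R o\<^sub>L T = T o\<^sub>L R \<Longrightarrow> R o\<^sub>L Y = Y o\<^sub>L R"
    by auto
  define S where "S = sqrt K *\<^sub>R (id_blinfun - Y)"
  have S: "self_adjoint S"
    unfolding S_def by (intro self_adjoint_scaleR self_adjoint_diff self_adjoint_id Y)
  moreover have "c *\<^sub>R id_blinfun \<preceq> S"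
    unfolding scaleR_id_le_iff[OF S]
  proof
    fix x
    have "inner (blinfun_apply Y x) x \<le> norm (blinfun_apply Y x) * norm x"
      by (rule norm_cauchy_schwarz)
    also have "\<dots> \<le> (r * norm x) * norm x"
      using Y(2) by (intro mult_right_mono order_trans[OF norm_blinfun] mult_right_mono) auto
    finally have "sqrt K * inner (blinfun_apply Y x) x \<le> sqrt K * (r * (norm x)\<^sup>2)"
      using K0 by (intro mult_left_mono) (simp_all add: power2_eq_square)
    also have "sqrt K * (r * (norm x)\<^sup>2) = sqrt K * (norm x)\<^sup>2 - c * (norm x)\<^sup>2"
      using K0 by (simp add: r_def algebra_simps)
    finally show "c * (norm x)\<^sup>2 \<le> inner (blinfun_apply S x) x"
      by (simp add: S_def blinfun.scaleR_left blinfun.diff_left inner_diff_left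
          power2_norm_eq_inner algebra_simps)
  qed
  moreover have "S o\<^sub>L S = T"
  proof (rule blinfun_eqI)
    fix x
    have "blinfun_apply Y (blinfun_apply Y x)
        = 2 *\<^sub>R blinfun_apply Y x - x + (1 / K) *\<^sub>R blinfun_apply T x"
      using arg_cong[OF fix_Y, of "\<lambda>T. 2 *\<^sub>R blinfun_apply T x"]
      by (simp add: f_def X_def blinfun.add_left blinfun.diff_left blinfun.scaleR_left algebra_simps)
    moreover have "blinfun_apply (S o\<^sub>L S) x
        = K *\<^sub>R (x - 2 *\<^sub>R blinfun_apply Y x + blinfun_apply Y (blinfun_apply Y x))"
      using K0
      by (simp add: S_def blinfun.diff_left blinfun.diff_right blinfun.scaleR_left
          blinfun.scaleR_right scaleR_2 algebra_simps)
    ultimately show "blinfun_apply (S o\<^sub>L S) x = blinfun_apply T x"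
      using K0 by simp
  qed
  moreover have "R o\<^sub>L S = S o\<^sub>L R" if "R o\<^sub>L T = T o\<^sub>L R" for R
  proof (rule blinfun_eqI)
    fix x
    show "blinfun_apply (R o\<^sub>L S) x = blinfun_apply (S o\<^sub>L R) x"
      using arg_cong[OF comm[OF that], of "\<lambda>T. blinfun_apply T x"]
      by (simp add: S_def blinfun.diff_left blinfun.diff_right blinfun.scaleR_left
          blinfun.scaleR_right)
  qed
  ultimately show ?thesis by blast
qed

text \<open>Let \<open>S\<close> be the root constructed above and \<open>R\<close> any positive root. As \<open>R\<close> commutes with \<open>R\<^sup>2 = T\<close>,
  it commutes with \<open>S\<close>, hence \<open>(S + R) (R - S) = R\<^sup>2 - S\<^sup>2 = 0\<close>. Since \<open>S + R \<ge> c > 0\<close>, the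
  vector \<open>R x - S x\<close> vanishes for every \<open>x\<close>.\<close>

lemma
  fixes T :: "'a::complex_hilbert_space \<Rightarrow>\<^sub>L 'a"
  assumes T: "self_adjoint T" and c: "0 < c" and low: "c\<^sup>2 *\<^sub>R id_blinfun \<preceq> T"
  shows op_sqrt_eqI: "op_pos R \<Longrightarrow> R o\<^sub>L R = T \<Longrightarrow> op_sqrt T = R"
    and self_adjoint_op_sqrt: "self_adjoint (op_sqrt T)"
    and op_sqrt_ge: "c *\<^sub>R id_blinfun \<preceq> op_sqrt T"
    and op_sqrt_square: "op_sqrt T o\<^sub>L op_sqrt T = T"
proof -
  obtain S where S: "self_adjoint S" "c *\<^sub>R id_blinfun \<preceq> S" "S o\<^sub>L S = T"
    and comm: "\<And>R. R o\<^sub>L T = T o\<^sub>L R \<Longrightarrow> R o\<^sub>L S = S o\<^sub>L R"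
    using strictly_positive_sqrt_exists[OF assms] by blast
  have unique: "R = S" if R: "op_pos R" "R o\<^sub>L R = T" for R
  proof (rule blinfun_eqI)
    fix x
    have "R o\<^sub>L T = T o\<^sub>L R"
      unfolding R(2)[symmetric] by (rule blinfun_eqI) simp
    from comm[OF this] have RS: "blinfun_apply R (blinfun_apply S x) = blinfun_apply S (blinfun_apply R x)"
      by (metis blinfun_apply_blinfun_compose)
    have RR: "blinfun_apply R (blinfun_apply R x) = blinfun_apply S (blinfun_apply S x)"
      by (metis R(2) S(3) blinfun_apply_blinfun_compose)
    define y where "y = blinfun_apply R x - blinfun_apply S x"
    have "blinfun_apply S y + blinfun_apply R y = 0"
      by (simp add: y_def blinfun.diff_right RS RR)
    hence "inner (blinfun_apply S y) y + inner (blinfun_apply R y) y = 0"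
      by (metis inner_add_left inner_zero_left)
    moreover have "0 \<le> inner (blinfun_apply R y) y"
      using R(1) by (simp add: op_pos_def inner_eq_Re_cinner)
    moreover have "c * (norm y)\<^sup>2 \<le> inner (blinfun_apply S y) y"
      using S(1,2) by (simp add: scaleR_id_le_iff)
    ultimately have "c * (norm y)\<^sup>2 \<le> 0" by linarith
    hence "y = 0" using c by (simp add: mult_le_0_iff)
    thus "blinfun_apply R x = blinfun_apply S x" by (simp add: y_def)
  qed
  have pos: "op_pos S"
    using strictly_positive_imp_op_pos[OF S(1) _ S(2)] c by simp
  have eq: "op_sqrt T = S"
    unfolding op_sqrt_def
    by (rule the_equality, intro conjI pos S(3)) (elim conjE, rule unique)
  show "op_sqrt T = R" if "op_pos R" "R o\<^sub>L R = T"
    using eq unique[OF that] by simp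
  show "self_adjoint (op_sqrt T)" "c *\<^sub>R id_blinfun \<preceq> op_sqrt T"
    "op_sqrt T o\<^sub>L op_sqrt T = T"
    using S eq by simp_all
qed

text \<open>For a self-adjoint root \<open>S\<close>, the bound \<open>S\<^sup>2 \<le> d\<^sup>2\<close> means \<open>\<parallel>S x\<parallel> \<le> d \<parallel>x\<parallel>\<close>.\<close>

lemma op_sqrt_le:
  assumes T: "self_adjoint T" and c: "0 < c" and low: "c\<^sup>2 *\<^sub>R id_blinfun \<preceq> T"
    and d: "0 \<le> d" and up: "T \<preceq> d\<^sup>2 *\<^sub>R id_blinfun"
  shows "op_sqrt T \<preceq> d *\<^sub>R id_blinfun"
  unfolding le_scaleR_id_iff[OF self_adjoint_op_sqrt[OF T c low]]
proof
  fix x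
  let ?S = "op_sqrt T"
  have "(norm (blinfun_apply ?S x))\<^sup>2 = inner (blinfun_apply T x) x"
    using self_adjoint_inner[OF self_adjoint_op_sqrt[OF T c low], of "blinfun_apply ?S x" x]
      arg_cong[OF op_sqrt_square[OF T c low], of "\<lambda>T. blinfun_apply T x"]
    by (simp add: power2_norm_eq_inner)
  also have "\<dots> \<le> (d * norm x)\<^sup>2"
    using up T by (simp add: le_scaleR_id_iff power_mult_distrib)
  finally have "norm (blinfun_apply ?S x) \<le> d * norm x"
    by (rule power2_le_imp_le) (simp add: d)
  hence "norm (blinfun_apply ?S x) * norm x \<le> d * (norm x)\<^sup>2"
    using mult_right_mono[OF _ norm_ge_zero[of x]] by (fastforce simp: power2_eq_square)
  thus "inner (blinfun_apply ?S x) x \<le> d * (norm x)\<^sup>2"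
    using norm_cauchy_schwarz order_trans by blast
qed

section \<open>The chord inequality and the geometric mean\<close>

text \<open>The quadratic form version of \<open>D\<^sup>2 + M m \<le> (M + m) D\<close>. It is \<open>X\<^sup>2 \<le> (M - m) X\<close> for
  \<open>X = D - m\<close>, expanded; passing through \<open>X\<close> covers \<open>M = m\<close> without a separate case.\<close>

lemma chord_inequality:
  assumes D: "self_adjoint D" and low: "m *\<^sub>R id_blinfun \<preceq> D" and up: "D \<preceq> M *\<^sub>R id_blinfun"
  shows "(norm (blinfun_apply D x))\<^sup>2 + (M * m) * (norm x)\<^sup>2
    \<le> (M + m) * inner (blinfun_apply D x) x"
proof -
  let ?X = "D - m *\<^sub>R id_blinfun"
  have X: "self_adjoint ?X"
    by (intro self_adjoint_diff self_adjoint_scaleR self_adjoint_id D)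
  have form: "inner (blinfun_apply ?X x) x = inner (blinfun_apply D x) x - m * (norm x)\<^sup>2" for x
    by (simp add: blinfun.diff_left blinfun.scaleR_left inner_diff_left power2_norm_eq_inner)
  have "(norm (blinfun_apply ?X x))\<^sup>2 \<le> (M - m) * inner (blinfun_apply ?X x) x"
  proof (rule square_le_multiple[OF X])
    show "0 \<le> inner (blinfun_apply ?X x) x" for x
      using low D by (simp add: form scaleR_id_le_iff)
    show "inner (blinfun_apply ?X x) x \<le> (M - m) * (norm x)\<^sup>2" for x
      using up D by (simp add: form le_scaleR_id_iff algebra_simps)
  qed
  moreover have "(norm (blinfun_apply ?X x))\<^sup>2 = (norm (blinfun_apply D x))\<^sup>2
      - 2 * m * inner (blinfun_apply D x) x + m\<^sup>2 * (norm x)\<^sup>2"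
    unfolding power2_norm_eq_inner
    by (simp add: blinfun.diff_left blinfun.scaleR_left inner_diff_left inner_diff_right
        inner_commute power2_eq_square algebra_simps)
  ultimately show ?thesis
    unfolding form by (simp add: algebra_simps power2_eq_square)
qed

lemma
  assumes T: "self_adjoint T" and c: "0 < c" and low: "c\<^sup>2 *\<^sub>R id_blinfun \<preceq> T"
  shows self_adjoint_op_inv_sqrt: "self_adjoint (op_inv (op_sqrt T))"
    and op_inv_sqrt_left: "op_inv (op_sqrt T) o\<^sub>L op_sqrt T = id_blinfun"
    and op_inv_sqrt_right: "op_sqrt T o\<^sub>L op_inv (op_sqrt T) = id_blinfun"
proof -
  obtain R where R: "R \<in> bop" "R o\<^sub>L op_sqrt T = id_blinfun" "op_sqrt T o\<^sub>L R = id_blinfun"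
    using strictly_positive_invertible[OF self_adjoint_op_sqrt[OF assms] c op_sqrt_ge[OF assms]]
    by blast
  have eq: "op_inv (op_sqrt T) = R"
    by (rule op_inv_eqI[OF R])
  show "self_adjoint (op_inv (op_sqrt T))" "op_inv (op_sqrt T) o\<^sub>L op_sqrt T = id_blinfun"
    "op_sqrt T o\<^sub>L op_inv (op_sqrt T) = id_blinfun"
    unfolding eq using R self_adjoint_inverse[OF self_adjoint_op_sqrt[OF assms]] by blast+
qed

text \<open>All inequalities are transported through the vectors: with \<open>S\<close> the root of \<open>A\<close> and \<open>D\<close> the middle
  factor of the mean, the forms of \<open>A\<close>, \<open>B\<close>, \<open>A \<sharp> B\<close> at \<open>x\<close> are those of \<open>1\<close>, \<open>D\<^sup>2\<close>, \<open>D\<close> at \<open>S x\<close>, so the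
  chord inequality at \<open>S x\<close> is the claim at \<open>x\<close>.\<close>

lemma
  fixes A B :: "'a::complex_hilbert_space \<Rightarrow>\<^sub>L 'a"
  assumes A: "self_adjoint A" and B: "self_adjoint B"
    and a: "0 < a" "a\<^sup>2 *\<^sub>R id_blinfun \<preceq> A"
    and m: "0 < m" "m\<^sup>2 *\<^sub>R A \<preceq> B" and M: "0 \<le> M" "B \<preceq> M\<^sup>2 *\<^sub>R A"
  shows self_adjoint_geo_mean: "self_adjoint (A \<sharp> B)"
    and chord_le_geo_mean: "(M * m) *\<^sub>R A + B \<preceq> (M + m) *\<^sub>R (A \<sharp> B)"
proof -
  define S where "S = op_sqrt A"
  define R where "R = op_inv S"
  define C where "C = R o\<^sub>L B o\<^sub>L R"
  define D where "D = op_sqrt C"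
  have S: "self_adjoint S" and SS: "blinfun_apply S (blinfun_apply S x) = blinfun_apply A x" for x
    unfolding S_def using self_adjoint_op_sqrt[OF A a] op_sqrt_square[OF A a]
    by (simp_all flip: blinfun_apply_blinfun_compose)
  have R: "self_adjoint R" and SR: "blinfun_apply S (blinfun_apply R x) = x"
    and RS: "blinfun_apply R (blinfun_apply S x) = x" for x
    unfolding R_def S_def
    using self_adjoint_op_inv_sqrt[OF A a] op_inv_sqrt_left[OF A a] op_inv_sqrt_right[OF A a]
    by (simp_all flip: blinfun_apply_blinfun_compose)
  have C: "self_adjoint C"
    unfolding C_def by (rule self_adjoint_conjugate[OF R B])
  have C_form: "inner (blinfun_apply C x) x
      = inner (blinfun_apply B (blinfun_apply R x)) (blinfun_apply R x)" for x
    by (simp add: C_def self_adjoint_inner[OF R])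
  have A_form: "inner (blinfun_apply A (blinfun_apply R x)) (blinfun_apply R x) = (norm x)\<^sup>2" for x
    by (simp add: SS[symmetric] self_adjoint_inner[OF S] SR power2_norm_eq_inner)
  have mA: "m\<^sup>2 * inner (blinfun_apply A x) x \<le> inner (blinfun_apply B x) x" for x
    using m(2) unfolding op_le_def
    by (subst (asm) op_pos_iff_inner)
      (simp_all add: A B self_adjoint_diff self_adjoint_scaleR blinfun.diff_left
        blinfun.scaleR_left inner_diff_left)
  have MA: "inner (blinfun_apply B x) x \<le> M\<^sup>2 * inner (blinfun_apply A x) x" for x
    using M(2) unfolding op_le_def
    by (subst (asm) op_pos_iff_inner)
      (simp_all add: A B self_adjoint_diff self_adjoint_scaleR blinfun.diff_left
        blinfun.scaleR_left inner_diff_left)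
  have C_ge: "m\<^sup>2 *\<^sub>R id_blinfun \<preceq> C"
    using mA[of "blinfun_apply R _"] by (simp add: scaleR_id_le_iff[OF C] C_form A_form)
  have C_le: "C \<preceq> M\<^sup>2 *\<^sub>R id_blinfun"
    using MA[of "blinfun_apply R _"] by (simp add: le_scaleR_id_iff[OF C] C_form A_form)
  have D: "self_adjoint D" and DD: "D o\<^sub>L D = C"
    and D_bounds: "m *\<^sub>R id_blinfun \<preceq> D" "D \<preceq> M *\<^sub>R id_blinfun"
    unfolding D_def
    using self_adjoint_op_sqrt[OF C m(1) C_ge] op_sqrt_square[OF C m(1) C_ge]
      op_sqrt_ge[OF C m(1) C_ge] op_sqrt_le[OF C m(1) C_ge M(1) C_le] by simp_all
  have G: "A \<sharp> B = S o\<^sub>L D o\<^sub>L S"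
    by (simp add: geo_mean_def D_def C_def R_def S_def)
  show sa: "self_adjoint (A \<sharp> B)"
    unfolding G by (rule self_adjoint_conjugate[OF S D])
  have B_form: "inner (blinfun_apply B x) x = (norm (blinfun_apply D (blinfun_apply S x)))\<^sup>2" for x
  proof -
    have "inner (blinfun_apply B x) x = inner (blinfun_apply C (blinfun_apply S x)) (blinfun_apply S x)"
      by (simp add: C_form RS)
    also have "\<dots> = (norm (blinfun_apply D (blinfun_apply S x)))\<^sup>2"
      by (simp add: DD[symmetric] self_adjoint_inner[OF D] power2_norm_eq_inner)
    finally show ?thesis .
  qed
  have A_form': "inner (blinfun_apply A x) x = (norm (blinfun_apply S x))\<^sup>2" for x
    by (simp add: SS[symmetric] self_adjoint_inner[OF S] power2_norm_eq_inner)
  have G_form: "inner (blinfun_apply (A \<sharp> B) x) x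
      = inner (blinfun_apply D (blinfun_apply S x)) (blinfun_apply S x)" for x
    by (simp add: G self_adjoint_inner[OF S])
  show "(M * m) *\<^sub>R A + B \<preceq> (M + m) *\<^sub>R (A \<sharp> B)"
    unfolding op_le_def
  proof (subst op_pos_iff_inner)
    show "self_adjoint ((M + m) *\<^sub>R (A \<sharp> B) - ((M * m) *\<^sub>R A + B))"
      by (intro self_adjoint_diff self_adjoint_add self_adjoint_scaleR sa A B)
    show "\<forall>x. 0 \<le> inner (blinfun_apply ((M + m) *\<^sub>R (A \<sharp> B) - ((M * m) *\<^sub>R A + B)) x) x"
      using chord_inequality[OF D D_bounds, of "blinfun_apply S _"]
      by (simp add: blinfun.diff_left blinfun.add_left blinfun.scaleR_left inner_diff_left
          inner_add_left A_form' B_form G_form add.commute)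
  qed
qed

text \<open>With \<open>R = A\<^sup>-\<^sup>1\<^sup>/\<^sup>2\<close>, the operator under the inner root is \<open>R\<^sup>4\<close>, whose positive root is \<open>R\<^sup>2\<close>;
  the outer factors then cancel it.\<close>

lemma geo_mean_op_inv:
  assumes A: "self_adjoint A" and a: "0 < a" "a\<^sup>2 *\<^sub>R id_blinfun \<preceq> A"
  shows "A \<sharp> op_inv A = id_blinfun"
proof -
  define S where "S = op_sqrt A"
  define R where "R = op_inv S"
  have S: "self_adjoint S" and SS: "blinfun_apply A x = blinfun_apply S (blinfun_apply S x)" for x
    unfolding S_def using self_adjoint_op_sqrt[OF A a] op_sqrt_square[OF A a]
    by (simp_all flip: blinfun_apply_blinfun_compose)
  have R: "self_adjoint R" and SR: "blinfun_apply S (blinfun_apply R x) = x"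
    and RS: "blinfun_apply R (blinfun_apply S x) = x" for x
    unfolding R_def S_def
    using self_adjoint_op_inv_sqrt[OF A a] op_inv_sqrt_left[OF A a] op_inv_sqrt_right[OF A a]
    by (simp_all flip: blinfun_apply_blinfun_compose)
  have inv: "op_inv A = R o\<^sub>L R"
    by (rule op_inv_eqI)
      (auto intro!: blinfun_eqI compose_in_bop self_adjoint_imp_bop[OF R] simp: SS SR RS)
  define C where "C = (R o\<^sub>L R) o\<^sub>L (R o\<^sub>L R)"
  have RR: "self_adjoint (R o\<^sub>L R)"
    by (rule self_adjoint_square[OF R])
  have C: "self_adjoint C"
    unfolding C_def by (rule self_adjoint_square[OF RR])
  \<comment> \<open>Uniqueness of the root of \<open>C = A\<^sup>-\<^sup>2\<close> asks for a positive lower bound. Since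
    \<open>x = A (R\<^sup>2 x)\<close>, the norm of \<open>R\<^sup>2 x\<close> is at least \<open>\<parallel>x\<parallel> / \<parallel>A\<parallel>\<close>; adding 1 avoids dividing by zero.\<close>
  let ?c = "1 / (norm A + 1)"
  have c: "0 < ?c" using norm_ge_zero[of A] by (simp add: add_nonneg_pos)
  have "?c\<^sup>2 *\<^sub>R id_blinfun \<preceq> C"
    unfolding scaleR_id_le_iff[OF C]
  proof
    fix x
    let ?y = "blinfun_apply (R o\<^sub>L R) x"
    have "norm x = norm (blinfun_apply A ?y)"
      by (simp add: SS SR)
    also have "\<dots> \<le> norm A * norm ?y"
      by (rule norm_blinfun)
    also have "\<dots> \<le> (norm A + 1) * norm ?y"
      by (intro mult_right_mono) auto
    finally have "?c * norm x \<le> norm ?y"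
      using c by (simp add: field_simps zero_less_divide_iff)
    hence "(?c * norm x)\<^sup>2 \<le> (norm ?y)\<^sup>2"
      using c by (intro power_mono) auto
    also have "\<dots> = inner (blinfun_apply C x) x"
      using self_adjoint_inner[OF RR, of ?y x] by (simp add: C_def power2_norm_eq_inner)
    finally show "?c\<^sup>2 * (norm x)\<^sup>2 \<le> inner (blinfun_apply C x) x"
      by (simp only: power_mult_distrib)
  qed
  hence "op_sqrt C = R o\<^sub>L R"
  proof (rule op_sqrt_eqI[OF C c])
    show "op_pos (R o\<^sub>L R)"
      by (simp add: op_pos_iff_inner[OF RR] self_adjoint_inner[OF R, of "blinfun_apply R _"])
  qed (simp add: C_def)
  moreover have "R o\<^sub>L op_inv A o\<^sub>L R = C"
    by (rule blinfun_eqI) (simp add: inv C_def)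
  ultimately have "A \<sharp> op_inv A = S o\<^sub>L (R o\<^sub>L R) o\<^sub>L S"
    by (simp add: geo_mean_def S_def R_def)
  also have "\<dots> = id_blinfun"
    by (rule blinfun_eqI) (simp add: RS SR)
  finally show ?thesis .
qed

section \<open>Positive linear maps\<close>

lemma op_linear_map_scaleR:
  assumes "op_linear_map \<Phi>" and "X \<in> bop"
  shows "\<Phi> (r *\<^sub>R X) = r *\<^sub>R \<Phi> X"
proof -
  have "op_scaleC (complex_of_real r) T = r *\<^sub>R T" for T :: "'c::complex_hilbert_space \<Rightarrow>\<^sub>L 'c"
    by (rule blinfun_eqI) (simp add: op_scaleC_apply blinfun.scaleR_left scaleR_eq_scaleC)
  thus ?thesis
    using assms unfolding op_linear_map_def by metis
qed

lemma positive_linear_map_mono: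
  assumes "op_linear_map \<Phi>" and "positive_map \<Phi>" and "X \<in> bop" and "Y \<in> bop" and "X \<preceq> Y"
  shows "\<Phi> X \<preceq> \<Phi> Y"
proof -
  have "\<Phi> (Y - X) = \<Phi> Y - \<Phi> X"
    using assms(1,3,4) op_linear_map_scaleR[OF assms(1,3), of "-1"] scaleR_in_bop[OF assms(3), of "-1"]
    unfolding op_linear_map_def by (metis diff_conv_add_uminus scaleR_minus1_left)
  thus ?thesis
    using assms(2,5) unfolding op_le_def positive_map_def by metis
qed

theorem theorem2p13:
  fixes A B :: "'a::complex_hilbert_space \<Rightarrow>\<^sub>L 'a"
    and \<Phi> :: "('a \<Rightarrow>\<^sub>L 'a) \<Rightarrow> ('b::complex_hilbert_space \<Rightarrow>\<^sub>L 'b)"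
    and m\<^sub>1 M\<^sub>1 m\<^sub>2 M\<^sub>2 m M :: real
  assumes "self_adjoint A" and "self_adjoint B"
    and "op_linear_map \<Phi>" and "positive_map \<Phi>" and "unital_map \<Phi>"
    and "0 < m\<^sub>1" and "0 < M\<^sub>1" and "0 < m\<^sub>2" and "0 < M\<^sub>2"
    and "m\<^sub>1\<^sup>2 *\<^sub>R id_blinfun \<preceq> A" and "A \<preceq> M\<^sub>1\<^sup>2 *\<^sub>R id_blinfun"
    and "m\<^sub>2\<^sup>2 *\<^sub>R id_blinfun \<preceq> B" and "B \<preceq> M\<^sub>2\<^sup>2 *\<^sub>R id_blinfun"
    and "m = m\<^sub>2 / M\<^sub>1" and "M = M\<^sub>2 / m\<^sub>1"
  shows "(\<Phi> A \<sharp> \<Phi> B)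
           + (1/2) *\<^sub>R (sqrt (M * m) *\<^sub>R \<Phi> A + (1 / sqrt (M * m)) *\<^sub>R \<Phi> B - 2 *\<^sub>R (\<Phi> A \<sharp> \<Phi> B))
         \<preceq> ((M + m) / (2 * sqrt (m * M))) *\<^sub>R \<Phi> (A \<sharp> B)
       \<and> (B = op_inv A \<longrightarrow>
           (\<forall>m' M'. 0 < m' \<and> 0 < M' \<and> m'\<^sup>2 = m \<and> M'\<^sup>2 = M \<longrightarrow>
             (\<Phi> A \<sharp> \<Phi> (op_inv A))
               + (1/2) *\<^sub>R ((M' * m') *\<^sub>R \<Phi> A + (1 / (M' * m')) *\<^sub>R \<Phi> (op_inv A)
                           - 2 *\<^sub>R (\<Phi> A \<sharp> \<Phi> (op_inv A)))
             \<preceq> ((M'\<^sup>2 + m'\<^sup>2) / (2 * m' * M')) *\<^sub>R id_blinfun))"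
proof -
  note A = assms(1) and B = assms(2) and lin = assms(3) and pos = assms(4) and unital = assms(5)
  note m1 = assms(6) and M1 = assms(7) and m2 = assms(8) and M2 = assms(9)
  note bounds = assms(10-13)
  have m: "0 < m" and M: "0 < M"
    using m1 M1 m2 M2 assms(14,15) by simp_all
  have low_A: "m\<^sub>1\<^sup>2 * (norm x)\<^sup>2 \<le> inner (blinfun_apply A x) x"
    and up_A: "inner (blinfun_apply A x) x \<le> M\<^sub>1\<^sup>2 * (norm x)\<^sup>2"
    and low_B: "m\<^sub>2\<^sup>2 * (norm x)\<^sup>2 \<le> inner (blinfun_apply B x) x"
    and up_B: "inner (blinfun_apply B x) x \<le> M\<^sub>2\<^sup>2 * (norm x)\<^sup>2" for x
    using bounds A B by (simp_all add: scaleR_id_le_iff le_scaleR_id_iff)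
  have mA: "m\<^sup>2 *\<^sub>R A \<preceq> B"
    unfolding op_le_def
  proof (subst op_pos_iff_inner)
    have "m\<^sup>2 * inner (blinfun_apply A x) x \<le> inner (blinfun_apply B x) x" for x
    proof -
      have "m\<^sup>2 * inner (blinfun_apply A x) x \<le> m\<^sup>2 * (M\<^sub>1\<^sup>2 * (norm x)\<^sup>2)"
        by (intro mult_left_mono up_A) simp
      also have "\<dots> = m\<^sub>2\<^sup>2 * (norm x)\<^sup>2"
        using M1 assms(14) by (simp add: power_divide)
      finally show ?thesis using low_B[of x] by simp
    qed
    thus "\<forall>x. 0 \<le> inner (blinfun_apply (B - m\<^sup>2 *\<^sub>R A) x) x"
      by (simp add: blinfun.diff_left blinfun.scaleR_left inner_diff_left)
  qed (intro self_adjoint_diff self_adjoint_scaleR A B)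
  have MA: "B \<preceq> M\<^sup>2 *\<^sub>R A"
    unfolding op_le_def
  proof (subst op_pos_iff_inner)
    have "inner (blinfun_apply B x) x \<le> M\<^sup>2 * inner (blinfun_apply A x) x" for x
    proof -
      have "M\<^sub>2\<^sup>2 * (norm x)\<^sup>2 = M\<^sup>2 * (m\<^sub>1\<^sup>2 * (norm x)\<^sup>2)"
        using m1 assms(15) by (simp add: power_divide)
      also have "\<dots> \<le> M\<^sup>2 * inner (blinfun_apply A x) x"
        by (intro mult_left_mono low_A) simp
      finally show ?thesis using up_B[of x] by simp
    qed
    thus "\<forall>x. 0 \<le> inner (blinfun_apply (M\<^sup>2 *\<^sub>R A - B) x) x"
      by (simp add: blinfun.diff_left blinfun.scaleR_left inner_diff_left)
  qed (intro self_adjoint_diff self_adjoint_scaleR A B)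
  note chord = self_adjoint_geo_mean[OF A B m1 bounds(1) m mA less_imp_le[OF M] MA]
    chord_le_geo_mean[OF A B m1 bounds(1) m mA less_imp_le[OF M] MA]
  have bops: "A \<in> bop" "B \<in> bop" "A \<sharp> B \<in> bop"
    using A B chord(1) by (simp_all add: self_adjoint_imp_bop)
  have "\<Phi> ((M * m) *\<^sub>R A + B) \<preceq> \<Phi> ((M + m) *\<^sub>R (A \<sharp> B))"
    by (intro positive_linear_map_mono[OF lin pos _ _ chord(2)] bop_intros bops)
  moreover have "\<Phi> ((M * m) *\<^sub>R A + B) = (M * m) *\<^sub>R \<Phi> A + \<Phi> B"
    using lin bops scaleR_in_bop[OF bops(1)] op_linear_map_scaleR[OF lin bops(1)]
    by (simp add: op_linear_map_def)
  ultimately have key: "op_pos ((M + m) *\<^sub>R \<Phi> (A \<sharp> B) - ((M * m) *\<^sub>R \<Phi> A + \<Phi> B))"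
    using op_linear_map_scaleR[OF lin bops(3)] by (simp add: op_le_def)
  define s where "s = sqrt (M * m)"
  have s: "0 < s" and s2: "M * m = s * s"
    using m M by (simp_all add: s_def)
  \<comment> \<open>The mean of the images, written \<open>G\<close>, cancels; what is left is \<open>key\<close> divided by \<open>2 s\<close>.\<close>
  have main: "G + (1/2) *\<^sub>R (s *\<^sub>R \<Phi> A + (1 / s) *\<^sub>R \<Phi> B - 2 *\<^sub>R G)
      \<preceq> ((M + m) / (2 * s)) *\<^sub>R \<Phi> (A \<sharp> B)" for G
  proof -
    have "((M + m) / (2 * s)) *\<^sub>R \<Phi> (A \<sharp> B)
        - (G + (1/2) *\<^sub>R (s *\<^sub>R \<Phi> A + (1 / s) *\<^sub>R \<Phi> B - 2 *\<^sub>R G))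
      = (1 / (2 * s)) *\<^sub>R ((M + m) *\<^sub>R \<Phi> (A \<sharp> B) - ((M * m) *\<^sub>R \<Phi> A + \<Phi> B))"
      using s unfolding s2 by (simp add: scaleR_diff_right scaleR_add_right)
    thus ?thesis
      using op_pos_scaleR[OF key, of "1 / (2 * s)"] s by (simp add: op_le_def)
  qed
  show ?thesis
  proof (intro conjI impI allI)
    show "(\<Phi> A \<sharp> \<Phi> B)
        + (1/2) *\<^sub>R (sqrt (M * m) *\<^sub>R \<Phi> A + (1 / sqrt (M * m)) *\<^sub>R \<Phi> B - 2 *\<^sub>R (\<Phi> A \<sharp> \<Phi> B))
      \<preceq> ((M + m) / (2 * sqrt (m * M))) *\<^sub>R \<Phi> (A \<sharp> B)"
      using main by (simp add: s_def mult.commute)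
  next
    fix m' M' :: real
    assume inv: "B = op_inv A" and m'M': "0 < m' \<and> 0 < M' \<and> m'\<^sup>2 = m \<and> M'\<^sup>2 = M"
    have s': "s = M' * m'"
      unfolding s_def using m'M' by (intro real_sqrt_unique) (auto simp: power_mult_distrib)
    have "\<Phi> (A \<sharp> B) = id_blinfun"
      using geo_mean_op_inv[OF A m1 bounds(1)] unital inv by (simp add: unital_map_def)
    thus "(\<Phi> A \<sharp> \<Phi> (op_inv A))
        + (1/2) *\<^sub>R ((M' * m') *\<^sub>R \<Phi> A + (1 / (M' * m')) *\<^sub>R \<Phi> (op_inv A)
                    - 2 *\<^sub>R (\<Phi> A \<sharp> \<Phi> (op_inv A)))
      \<preceq> ((M'\<^sup>2 + m'\<^sup>2) / (2 * m' * M')) *\<^sub>R id_blinfun"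
      using main[of "\<Phi> A \<sharp> \<Phi> B"] m'M' unfolding s' inv by (simp add: ac_simps)
  qed
qed

end
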